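(* Let $Y$ be a Poisson random variable with parameter $\alpha>0$, and define $B_{n}^{(c,Y)}(x)$ by $$e^{x(E[e^{\frac{Y}{2}t}]-E[e^{-\frac{Y}{2}t}])}= \sum_{n=0}^{\infty}B_{n}^{(c,Y)}(x)\frac{t^{n}}{n!}.$$ Then for every $n\ge 0$, $$B_{n}^{(c,Y)}(x)=\frac{1}{2^{n}}\sum_{l=0}^{n}\sum_{k=0}^{l}\sum_{j=0}^{n-l} (-1)^{l}\binom{n}{l}{n-l\brace j}{l\brace k}\alpha^{j+k} \phi_{j}(x)\, \phi_{k}(-x).$$
   Context: ${n\brace k}$ denotes the Stirling numbers of the second kind, given by $x^n=\sum_{k=0}^n{n\brace k}x(x-1)\cdots(x-k+1)$, and $\phi_n(x)=\sum_{k=0}^n{n\brace k}x^k$ are the Bell polynomials. *)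

theory Defs
  imports "HOL-Probability.Probability" "HOL-Combinatorics.Stirling"
begin

definition bell_poly :: "nat \<Rightarrow> real \<Rightarrow> real" where
  "bell_poly n x = (\<Sum>k=0..n. real (Stirling n k) * x ^ k)"

text \<open>
  The library introduces \<^const>\<open>Stirling\<close> by its recurrence; this is the
  expansion into falling factorials.
\<close>

lemma power_eq_sum_Stirling:
  fixes x :: "'a :: comm_ring_1"
  shows "x ^ n = (\<Sum>k=0..n. of_nat (Stirling n k) * (\<Prod>i<k. x - of_nat i))"
proof (induction n)
  case 0
  then show ?case by simp
next
  case (Suc n)
  define F where "F k = (\<Prod>i<k. x - of_nat i)" for k
  have F: "x * F k = F (Suc k) + of_nat k * F k" for k
    by (simp add: F_def algebra_simps)
  have "(\<Sum>k=0..Suc n. of_nat (Stirling (Suc n) k) * F k)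
      = (\<Sum>k=0..n. of_nat (Stirling (Suc n) (Suc k)) * F (Suc k))"
    by (subst sum.atLeast0_atMost_Suc_shift) simp
  also have "\<dots> = (\<Sum>k=0..n. of_nat (Stirling n k) * F (Suc k))
      + (\<Sum>k=0..n. of_nat (Suc k) * of_nat (Stirling n (Suc k)) * F (Suc k))"
    by (simp add: sum.distrib algebra_simps)
  also have "(\<Sum>k=0..n. of_nat (Suc k) * of_nat (Stirling n (Suc k)) * F (Suc k))
      = (\<Sum>k=0..Suc n. of_nat k * of_nat (Stirling n k) * F k)"
    by (subst sum.atLeast0_atMost_Suc_shift) simp
  also have "\<dots> = (\<Sum>k=0..n. of_nat k * of_nat (Stirling n k) * F k)"
    by simp
  also have "(\<Sum>k=0..n. of_nat (Stirling n k) * F (Suc k)) + \<dots>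
      = (\<Sum>k=0..n. of_nat (Stirling n k) * (x * F k))"
    by (simp add: F sum.distrib [symmetric] algebra_simps)
  also have "\<dots> = x * (\<Sum>k=0..n. of_nat (Stirling n k) * F k)"
    by (simp add: sum_distrib_left mult_ac)
  finally show ?case
    using Suc.IH by (simp add: F_def)
qed

text \<open>
  The exponential generating function identity is required to hold for all real \<open>t\<close> in some
  neighbourhood of \<open>0\<close>.  The description denotes only when the exponential on the right is the
  sum of a power series near \<open>0\<close>; uniqueness of the coefficients is shown below.
\<close>

definition prob_central_bell :: "'a measure \<Rightarrow> ('a \<Rightarrow> real) \<Rightarrow> nat \<Rightarrow> real \<Rightarrow> real" where
  "prob_central_bell M Y n x =
     (THE b :: nat \<Rightarrow> real. \<forall>\<^sub>F t in nhds 0.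
        (\<lambda>m. b m * t ^ m / fact m) sums
          exp (x * ((LINT \<omega>|M. exp (Y \<omega> / 2 * t)) - (LINT \<omega>|M. exp (- (Y \<omega> / 2) * t))))) n"

lemma egf_coeff_unique:
  fixes b c :: "nat \<Rightarrow> real"
  assumes "\<forall>\<^sub>F t in nhds 0. (\<lambda>m. b m * t ^ m / fact m) sums f t"
    and "\<forall>\<^sub>F t in nhds 0. (\<lambda>m. c m * t ^ m / fact m) sums f t"
  shows "b = c"
proof (rule ccontr)
  assume "b \<noteq> c"
  define d where "d m = (b m - c m) / fact m" for m
  have "\<exists>m. d m \<noteq> 0"
    using \<open>b \<noteq> c\<close> by (auto simp: d_def fun_eq_iff)
  define N where "N = (LEAST m. d m \<noteq> 0)"
  have less_N: "d m = 0" if "m < N" for m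
    using not_less_Least that unfolding N_def by blast
  have dN: "d N \<noteq> 0"
    using LeastI_ex [OF \<open>\<exists>m. d m \<noteq> 0\<close>] unfolding N_def by blast
  have "\<forall>\<^sub>F t in nhds 0. (\<lambda>m. d m * t ^ m) sums 0"
    using assms
  proof eventually_elim
    case (elim t)
    from sums_diff [OF elim] show ?case
      by (simp add: d_def algebra_simps diff_divide_distrib)
  qed
  then obtain r where r: "r > 0" "\<And>t. norm t < r \<Longrightarrow> (\<lambda>m. d m * t ^ m) sums 0"
    unfolding eventually_nhds_metric by auto
  have "(\<lambda>m. d (m + N) * t ^ m) sums 0" if "t \<noteq> 0" "norm t < r" for t
  proof -
    have "(\<lambda>m. d (m + N) * t ^ (m + N)) sums (0 - (\<Sum>m<N. d m * t ^ m))"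
      using r(2) [OF that(2)] by (subst sums_iff_shift) simp
    then have "(\<lambda>m. t ^ N * (d (m + N) * t ^ m)) sums (t ^ N * 0)"
      by (simp add: less_N power_add mult_ac)
    then show ?thesis
      using that(1) by (subst (asm) sums_mult_iff) auto
  qed
  then have "((\<lambda>t::real. 0) \<longlongrightarrow> d (0 + N)) (at 0)"
    using r(1) by (intro powser_limit_0_strong [where a = "\<lambda>m. d (m + N)" and s = r]) auto
  then show False
    using dN by (simp add: tendsto_const_iff)
qed

lemma prob_central_bell_eqI:
  assumes "\<forall>\<^sub>F t in nhds 0. (\<lambda>m. b m * t ^ m / fact m) sums
      exp (x * ((LINT \<omega>|M. exp (Y \<omega> / 2 * t)) - (LINT \<omega>|M. exp (- (Y \<omega> / 2) * t))))"
  shows "prob_central_bell M Y n x = b n"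
proof -
  have "(THE b :: nat \<Rightarrow> real. \<forall>\<^sub>F t in nhds 0. (\<lambda>m. b m * t ^ m / fact m) sums
      exp (x * ((LINT \<omega>|M. exp (Y \<omega> / 2 * t)) - (LINT \<omega>|M. exp (- (Y \<omega> / 2) * t))))) = b"
    using assms by (intro the_equality) (auto intro: egf_coeff_unique)
  then show ?thesis
    by (simp add: prob_central_bell_def)
qed

end

theory Submission
  imports Defs
begin

text \<open>
  Substituting \<open>exp u - 1\<close> into an entire exponential generating function
  \<open>\<Sum>j. a j * z ^ j / fact j\<close> replaces the coefficients \<open>a\<close> by their Stirling transform
  \<open>m \<mapsto> \<Sum>j. Stirling m j * a j\<close>.  Doing this twice, first for \<open>exp (x * z)\<close> and then for the
  resulting Bell series rescaled by \<open>\<alpha>\<close>, expands \<open>exp (x * (exp (\<alpha> * (exp u - 1)) - 1))\<close>.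
  The generating function of the theorem is the product of this function at \<open>(x, t / 2)\<close> and
  at \<open>(- x, - t / 2)\<close>, so the claim is a Cauchy product.
\<close>

text \<open>Write \<open>E\<close> for the series of \<open>exp u - 1\<close>. Since
  \<open>E' = E + 1\<close>, the derivative of \<open>E ^ k\<close> is
  \<open>k * (E ^ k + E ^ (k - 1))\<close> for positive \<open>k\<close>; comparing coefficients
  gives exactly the recurrence of the Stirling numbers.\<close>

lemma fps_nth_exp_minus_1_power:
  "fps_nth ((fps_exp 1 - 1 :: 'a :: field_char_0 fps) ^ k) n =
     fact k * of_nat (Stirling n k) / fact n"
proof (induction n arbitrary: k)
  case 0
  show ?case
    by (cases k) (simp_all add: fps_nth_power_0)
next
  case (Suc n)
  let ?E = "fps_exp 1 - 1 :: 'a fps"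
  show ?case
  proof (cases k)
    case 0
    then show ?thesis by simp
  next
    case k: (Suc k')
    have "fps_deriv (?E ^ k) = fps_const (of_nat k) * (?E ^ k + ?E ^ k')"
      unfolding fps_deriv_power by (simp add: k algebra_simps)
    then have "of_nat (Suc n) * fps_nth (?E ^ k) (Suc n) =
        of_nat k * (fps_nth (?E ^ k) n + fps_nth (?E ^ k') n)"
      by (metis Suc_eq_plus1 fps_add_nth fps_deriv_nth fps_mult_left_const_nth)
    also have "\<dots> = fact k * of_nat (Stirling (Suc n) k) / fact n"
      unfolding Suc.IH by (simp add: k field_simps)
    also have "\<dots> = of_nat (Suc n) * (fact k * of_nat (Stirling (Suc n) k) / fact (Suc n))"
      by (simp del: of_nat_Suc)
    finally show ?thesis
      using mult_left_cancel of_nat_eq_0_iff by blast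
  qed
qed

text \<open>The formal identity becomes one of convergent series because powers of
  \<open>exp u - 1\<close> have infinite radius of convergence.\<close>

lemma Stirling_egf_sums:
  fixes u :: "'a :: {banach, real_normed_field}"
  shows "(\<lambda>n. of_nat (Stirling n k) * u ^ n / fact n) sums ((exp u - 1) ^ k / fact k)"
proof -
  let ?E = "fps_exp 1 - 1 :: 'a fps"
  have radius_E: "fps_conv_radius ?E = \<infinity>"
    using fps_conv_radius_diff[of "fps_exp (1::'a)" 1] by simp
  have "fps_conv_radius (?E ^ k) = \<infinity>"
    using fps_conv_radius_power[of ?E k] radius_E by simp
  then have "(\<lambda>n. fps_nth (?E ^ k) n * u ^ n) sums eval_fps (?E ^ k) u"
    by (intro sums_eval_fps) simp
  moreover have "eval_fps (?E ^ k) u = (exp u - 1) ^ k"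
    by (simp add: eval_fps_power eval_fps_diff radius_E)
  ultimately have "(\<lambda>n. fact k * of_nat (Stirling n k) / fact n * u ^ n) sums (exp u - 1) ^ k"
    by (simp add: fps_nth_exp_minus_1_power)
  from sums_divide[OF this, of "fact k"] show ?thesis
    by (simp add: field_simps)
qed

text \<open>A power series that converges at a point converges absolutely at every point of smaller
  modulus; here the larger point is \<open>\<bar>z\<bar> + 1\<close>.\<close>

lemma summable_norm_egf:
  fixes a :: "nat \<Rightarrow> real"
  assumes "\<And>z. summable (\<lambda>j. a j * z ^ j / fact j)"
  shows "summable (\<lambda>j. norm (a j * z ^ j / fact j))"
proof -
  have "summable (\<lambda>j. norm (a j / fact j * z ^ j))"
    using assms[of "\<bar>z\<bar> + 1"] by (intro powser_insidea[where x = "\<bar>z\<bar> + 1"]) simp_all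
  then show ?thesis by simp
qed

text \<open>Expanding each power of \<open>exp u - 1\<close> in \<open>g (exp u - 1)\<close> by
  \<open>Stirling_egf_sums\<close> gives a double series. Its rows (fixed \<open>j\<close>) sum to
  the terms of \<open>g\<close>, its columns (fixed \<open>m\<close>) to the terms of the claim.
  Absolute convergence justifies the interchange.\<close>

lemma Stirling_transform_sums:
  fixes a :: "nat \<Rightarrow> real"
  assumes g: "\<And>z. (\<lambda>j. a j * z ^ j / fact j) sums g z"
  shows "(\<lambda>m. (\<Sum>j=0..m. real (Stirling m j) * a j) * u ^ m / fact m) sums g (exp u - 1)"
proof -
  define f where "f = (\<lambda>(j, m). a j * (real (Stirling m j) * u ^ m / fact m))"
  note abs_summable = summable_norm_egf[OF sums_summable[OF g]]
  have "(\<lambda>p. norm (f p)) summable_on UNIV \<times> UNIV"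
  proof (rule summable_on_SigmaI)
    fix j :: nat
    \<comment> \<open>Stirling numbers are nonnegative, so taking norms in a row only replaces
      \<open>u\<close> by \<open>\<bar>u\<bar>\<close> and \<open>a j\<close> by
      \<open>\<bar>a j\<bar>\<close>. The row sums are then the norms of the terms of
      \<open>g\<close> at \<open>exp \<bar>u\<bar> - 1\<close>.\<close>
    have "(\<lambda>m. \<bar>a j\<bar> * (real (Stirling m j) * \<bar>u\<bar> ^ m / fact m)) sums
        (\<bar>a j\<bar> * ((exp \<bar>u\<bar> - 1) ^ j / fact j))"
      by (intro sums_mult Stirling_egf_sums)
    then show "((\<lambda>m. norm (f (j, m))) has_sum (\<bar>a j\<bar> * ((exp \<bar>u\<bar> - 1) ^ j / fact j))) UNIV"
      by (intro sums_nonneg_imp_has_sum) (simp_all add: f_def abs_mult power_abs)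
  next
    show "(\<lambda>j. \<bar>a j\<bar> * ((exp \<bar>u\<bar> - 1) ^ j / fact j)) summable_on UNIV"
      using abs_summable[of "exp \<bar>u\<bar> - 1"]
      by (intro summable_nonneg_imp_summable_on) (simp_all add: abs_mult power_abs)
  qed auto
  then have summable_f: "f summable_on UNIV \<times> UNIV"
    by (rule abs_summable_summable)
  have row: "((\<lambda>m. f (j, m)) has_sum a j * ((exp u - 1) ^ j / fact j)) UNIV" for j
    unfolding f_def prod.case
  proof (intro norm_summable_imp_has_sum sums_mult Stirling_egf_sums)
    have "summable (\<lambda>m. norm (real (Stirling m j) * u ^ m / fact m))"
      by (rule summable_norm_egf[OF sums_summable[OF Stirling_egf_sums]])
    from summable_mult[OF this, of "\<bar>a j\<bar>"]
    show "summable (\<lambda>m. norm (a j * (real (Stirling m j) * u ^ m / fact m)))"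
      by (simp add: abs_mult)
  qed
  have "((\<lambda>j. a j * ((exp u - 1) ^ j / fact j)) has_sum g (exp u - 1)) UNIV"
    using norm_summable_imp_has_sum[OF abs_summable g] by simp
  then have "(f has_sum g (exp u - 1)) (UNIV \<times> UNIV)"
    using row summable_f by (intro has_sum_SigmaI) auto
  then have swapped: "((\<lambda>(m, j). f (j, m)) has_sum g (exp u - 1)) (UNIV \<times> UNIV)"
    by (subst (asm) has_sum_swap)
  have column: "((\<lambda>j. f (j, m)) has_sum
      (\<Sum>j=0..m. real (Stirling m j) * a j) * u ^ m / fact m) UNIV" for m
  proof -
    \<comment> \<open>Columns are finite sums, as \<open>Stirling m j\<close> vanishes for
      \<open>j > m\<close>.\<close>
    have "((\<lambda>j. f (j, m)) has_sum (\<Sum>j=0..m. f (j, m))) UNIV"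
      by (rule has_sum_finite_neutralI) (auto simp: f_def)
    then show ?thesis
      by (simp add: f_def sum_distrib_left sum_distrib_right sum_divide_distrib mult_ac)
  qed
  show ?thesis
    by (rule has_sum_imp_sums, rule has_sum_SigmaD[OF swapped]) (simp add: column)
qed

lemma bell_poly_egf_sums:
  "(\<lambda>m. bell_poly m x * z ^ m / fact m) sums exp (x * (exp z - 1))"
proof -
  have "(\<lambda>j. x ^ j * z ^ j / fact j) sums exp (x * z)" for z
    using exp_converges[of "x * z"] by (simp add: power_mult_distrib divide_inverse mult_ac)
  from Stirling_transform_sums[OF this] show ?thesis
    by (simp add: bell_poly_def)
qed

lemma iterated_bell_egf_sums:
  "(\<lambda>m. (\<Sum>j=0..m. real (Stirling m j) * (\<alpha> ^ j * bell_poly j x)) * u ^ m / fact m) sums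
     exp (x * (exp (\<alpha> * (exp u - 1)) - 1))"
proof -
  have "(\<lambda>j. \<alpha> ^ j * bell_poly j x * z ^ j / fact j) sums exp (x * (exp (\<alpha> * z) - 1))" for z
    using bell_poly_egf_sums[of x "\<alpha> * z"] by (simp add: power_mult_distrib mult_ac)
  from Stirling_transform_sums[OF this] show ?thesis .
qed

text \<open>The Cauchy product, with the factorials \<open>1 / (fact l * fact (n - l))\<close>
  rewritten as \<open>(n choose l) / fact n\<close>.\<close>

lemma egf_product_sums:
  fixes a b :: "nat \<Rightarrow> real"
  assumes f: "\<And>u. (\<lambda>m. a m * u ^ m / fact m) sums f u"
    and g: "\<And>u. (\<lambda>m. b m * u ^ m / fact m) sums g u"
  shows "(\<lambda>n. (\<Sum>l=0..n. real (n choose l) * a l * b (n - l)) * u ^ n / fact n) sums (f u * g u)"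
proof -
  have "(\<lambda>n. \<Sum>l\<le>n. (a l * u ^ l / fact l) * (b (n - l) * u ^ (n - l) / fact (n - l))) sums
      (f u * g u)"
    using Cauchy_product_sums[OF summable_norm_egf[OF sums_summable[OF f]]
        summable_norm_egf[OF sums_summable[OF g]], of u u]
    by (simp add: sums_unique[OF f, symmetric] sums_unique[OF g, symmetric])
  also have "(\<lambda>n. \<Sum>l\<le>n. (a l * u ^ l / fact l) * (b (n - l) * u ^ (n - l) / fact (n - l))) =
      (\<lambda>n. (\<Sum>l=0..n. real (n choose l) * a l * b (n - l)) * u ^ n / fact n)"
  proof
    fix n
    have "(a l * u ^ l / fact l) * (b (n - l) * u ^ (n - l) / fact (n - l)) =
        real (n choose l) * a l * b (n - l) * u ^ n / fact n" if "l \<le> n" for l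
      using that power_add[of u l "n - l"] by (simp add: binomial_fact field_simps)
    then show "(\<Sum>l\<le>n. (a l * u ^ l / fact l) * (b (n - l) * u ^ (n - l) / fact (n - l))) =
        (\<Sum>l=0..n. real (n choose l) * a l * b (n - l)) * u ^ n / fact n"
      by (simp add: sum_distrib_right sum_divide_distrib atLeast0AtMost)
  qed
  finally show ?thesis .
qed

text \<open>Weighted by the Poisson probabilities, \<open>exp (real k * s)\<close> yields
  \<open>exp (- \<alpha>)\<close> times the exponential series at
  \<open>\<alpha> * exp s\<close>.\<close>

lemma expectation_exp_poisson:
  assumes "\<alpha> > 0"
  shows "measure_pmf.expectation (poisson_pmf \<alpha>) (\<lambda>k. exp (real k * s)) = exp (\<alpha> * (exp s - 1))"
proof -
  define h where "h k = pmf (poisson_pmf \<alpha>) k * exp (real k * s)" for k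
  have "(\<lambda>k. exp (- \<alpha>) * ((\<alpha> * exp s) ^ k / fact k)) sums (exp (- \<alpha>) * exp (\<alpha> * exp s))"
    using exp_converges[of "\<alpha> * exp s"] by (intro sums_mult) (simp add: divide_inverse mult_ac)
  moreover have "h = (\<lambda>k. exp (- \<alpha>) * ((\<alpha> * exp s) ^ k / fact k))"
    using assms by (simp add: h_def power_mult_distrib exp_of_nat2_mult exp_of_nat_mult mult_ac fun_eq_iff)
  moreover have "exp (- \<alpha>) * exp (\<alpha> * exp s) = exp (\<alpha> * (exp s - 1))"
    by (simp add: exp_add [symmetric] algebra_simps)
  ultimately have h: "h sums exp (\<alpha> * (exp s - 1))" by simp
  have h_nonneg: "h k \<ge> 0" for k
    by (simp add: h_def pmf_nonneg del: pmf_poisson)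
  \<comment> \<open>Integrability needs absolute summability, which for nonnegative terms is
    summability.\<close>
  have "integrable (count_space UNIV) h"
    unfolding integrable_count_space_nat_iff
    using sums_summable[OF h] by (simp add: h_nonneg)
  moreover have "measure_pmf.expectation (poisson_pmf \<alpha>) (\<lambda>k. exp (real k * s)) =
      integral\<^sup>L (count_space UNIV) h"
    unfolding measure_pmf_eq_density h_def by (subst integral_density) simp_all
  ultimately show ?thesis
    using sums_unique[OF h] by (simp add: integral_count_space_nat)
qed

text \<open>The expectation depends only on the law of \<open>Y\<close>, so it can be computed under
  \<open>poisson_pmf\<close>.\<close>

lemma mgf_poisson_distributed:
  assumes "Y \<in> borel_measurable M" and "\<alpha> > 0"
    and "distr M borel Y = distr (measure_pmf (poisson_pmf \<alpha>)) borel real"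
  shows "(LINT \<omega>|M. exp (Y \<omega> * s)) = exp (\<alpha> * (exp s - 1))"
proof -
  have "(LINT \<omega>|M. exp (Y \<omega> * s)) = (LINT y|distr M borel Y. exp (y * s))"
    using assms(1) by (subst integral_distr) simp_all
  also have "\<dots> = measure_pmf.expectation (poisson_pmf \<alpha>) (\<lambda>k. exp (real k * s))"
    unfolding assms(3) by (subst integral_distr) simp_all
  finally show ?thesis
    using expectation_exp_poisson[OF assms(2)] by simp
qed

theorem theorem2p15:
  fixes M :: "'a measure" and Y :: "'a \<Rightarrow> real" and \<alpha> x :: real and n :: nat
  assumes "prob_space M"
    and "Y \<in> borel_measurable M"
    and "\<alpha> > 0"
    and "distr M borel Y = distr (measure_pmf (poisson_pmf \<alpha>)) borel real"
  shows "prob_central_bell M Y n x =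
    1 / 2 ^ n * (\<Sum>l=0..n. \<Sum>k=0..l. \<Sum>j=0..n-l.
      (-1) ^ l * real (n choose l) * real (Stirling (n - l) j) * real (Stirling l k) *
      \<alpha> ^ (j + k) * bell_poly j x * bell_poly k (- x))"
proof -
  define S where "S m y = (\<Sum>j=0..m. real (Stirling m j) * (\<alpha> ^ j * bell_poly j y))" for m y
  define G where "G y u = exp (y * (exp (\<alpha> * (exp u - 1)) - 1))" for y u
  have S: "(\<lambda>m. S m y * u ^ m / fact m) sums G y u" for y u
    unfolding S_def G_def by (rule iterated_bell_egf_sums)
  \<comment> \<open>Reversing the sign of \<open>u\<close> is the source of the factor
    \<open>(-1) ^ l\<close> in the result.\<close>
  have "(\<lambda>m. ((-1) ^ m * S m (- x)) * u ^ m / fact m) sums G (- x) (- u)" for u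
    using S[of "- x" "- u"] by (simp add: power_minus[of u] mult_ac)
  note prod = egf_product_sums[OF this S]
  \<comment> \<open>The coefficients of the product at \<open>u = t / 2\<close>; the halving
    produces \<open>1 / 2 ^ m\<close>.\<close>
  define c where
    "c m = 1 / 2 ^ m * (\<Sum>l=0..m. real (m choose l) * ((-1) ^ l * S l (- x)) * S (m - l) x)" for m
  have "(\<lambda>m. c m * t ^ m / fact m) sums
      exp (x * ((LINT \<omega>|M. exp (Y \<omega> / 2 * t)) - (LINT \<omega>|M. exp (- (Y \<omega> / 2) * t))))" for t
  proof -
    \<comment> \<open>When the exponents are added, the constants \<open>- 1\<close> inside the two
      factors \<open>G\<close> cancel, leaving \<open>x\<close> times the difference of the two
      expectations.\<close>
    have "G (- x) (- (t / 2)) * G x (t / 2) =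
        exp (x * ((LINT \<omega>|M. exp (Y \<omega> / 2 * t)) - (LINT \<omega>|M. exp (- (Y \<omega> / 2) * t))))"
      using mgf_poisson_distributed[OF assms(2-4), of "t / 2"]
        mgf_poisson_distributed[OF assms(2-4), of "- (t / 2)"]
      by (simp add: G_def exp_add [symmetric] algebra_simps)
    then show ?thesis
      using prod[of x "t / 2"] by (simp add: c_def power_divide mult_ac)
  qed
  then have "prob_central_bell M Y n x = c n"
    by (intro prob_central_bell_eqI always_eventually allI)
  also have "\<dots> = 1 / 2 ^ n * (\<Sum>l=0..n. \<Sum>k=0..l. \<Sum>j=0..n-l.
      (-1) ^ l * real (n choose l) * real (Stirling (n - l) j) * real (Stirling l k) *
      \<alpha> ^ (j + k) * bell_poly j x * bell_poly k (- x))"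
  proof -
    \<comment> \<open>The index \<open>k\<close> comes from the factor at \<open>- x\<close> and
      \<open>j\<close> from the factor at \<open>x\<close>; their powers of \<open>\<alpha>\<close>
      combine to \<open>\<alpha> ^ (j + k)\<close>.\<close>
    have "real (n choose l) * ((-1) ^ l * S l (- x)) * S (n - l) x =
        (\<Sum>k=0..l. \<Sum>j=0..n-l.
          (-1) ^ l * real (n choose l) * real (Stirling (n - l) j) * real (Stirling l k) *
          \<alpha> ^ (j + k) * bell_poly j x * bell_poly k (- x))" for l
    proof -
      have "real (n choose l) * ((-1) ^ l * S l (- x)) * S (n - l) x =
          (-1) ^ l * real (n choose l) * (S l (- x) * S (n - l) x)"
        by simp
      also have "\<dots> = (\<Sum>k=0..l. \<Sum>j=0..n-l. (-1) ^ l * real (n choose l) *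
          ((real (Stirling l k) * (\<alpha> ^ k * bell_poly k (- x))) *
           (real (Stirling (n - l) j) * (\<alpha> ^ j * bell_poly j x))))"
        by (simp only: S_def sum_product) (simp only: sum_distrib_left)
      finally show ?thesis
        by (simp add: power_add mult_ac)
    qed
    then show ?thesis
      by (simp add: c_def)
  qed
  finally show ?thesis .
qed

end
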